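(* Let $\kappa$ be an inaccessible cardinal and assume $2^\kappa=\kappa^+$. Then there exists a set $X\subseteq2^\kappa$ which is strong measure zero but not stationary strong measure zero.
   Context: For $\eta\in2^{<\kappa}$, $[\eta]=\{x\in2^\kappa\colon\eta\subseteq x\}$. $X\subseteq2^\kappa$ is strong measure zero iff for every $f\in\kappa^\kappa$ there are $(\eta_i)_{i<\kappa}$ with $\eta_i\in2^{f(i)}$ and $X\subseteq\bigcup_{i<\kappa}[\eta_i]$. $X$ is stationary strong measure zero iff for every $f\in\kappa^\kappa$ there are $(\eta_i)_{i<\kappa}$ with $\eta_i\in2^{f(i)}$ and $X\subseteq\bigcap_{C\subseteq\kappa\text{ club}}\bigcup_{i\in C}[\eta_i]$. *)

theory Defs
  imports Main
begin

unbundle cardinal_syntax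

text \<open>
  The cardinal \<open>\<kappa>\<close> is a cardinal well-order \<open>r\<close> in the sense of the library. The ordinals below
  \<open>\<kappa>\<close> are the elements of \<open>Field r\<close>, and \<open>underS r a\<close> is the ordinal \<open>a\<close> viewed as the set of its
  predecessors.
\<close>

text \<open>
  Every cardinal below \<open>r\<close> is realised by a relation on the carrier type of \<open>r\<close>, so letting \<open>m\<close> range
  over that type loses nothing.
\<close>

definition strong_limit :: "'a rel \<Rightarrow> bool" where
  "strong_limit r \<longleftrightarrow> (\<forall>m :: 'a rel. Card_order m \<and> m <o r \<longrightarrow> ctwo ^c m <o r)"

definition inaccessible :: "'a rel \<Rightarrow> bool" where
  "inaccessible r \<longleftrightarrow> Card_order r \<and> natLeq <o r \<and> regularCard r \<and> strong_limit r"

text \<open>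
  The condition on \<open>d\<close> says that \<open>d\<close> is a limit ordinal in which \<open>C \<inter> d\<close> is unbounded: it is
  nonzero, and strictly between any \<open>b < d\<close> and \<open>d\<close> there is an element of \<open>C\<close>.
\<close>

definition club :: "'a rel \<Rightarrow> 'a set \<Rightarrow> bool" where
  "club r C \<longleftrightarrow> C \<subseteq> Field r \<and> cofinal C r \<and>
    (\<forall>d \<in> Field r. underS r d \<noteq> {} \<and>
       (\<forall>b \<in> underS r d. \<exists>c \<in> C \<inter> underS r d. b \<noteq> c \<and> (b, c) \<in> r) \<longrightarrow> d \<in> C)"

text \<open>
  Elements of \<open>2\<close> to the power \<open>A\<close> are partial maps with domain exactly \<open>A\<close>, so that the extension
  relation between sequences of different lengths is inclusion of maps.
\<close>

definition two_pow :: "'a set \<Rightarrow> ('a \<rightharpoonup> bool) set" where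
  "two_pow A = {x. dom x = A}"

definition basic_open :: "'a rel \<Rightarrow> ('a \<rightharpoonup> bool) \<Rightarrow> ('a \<rightharpoonup> bool) set" where
  "basic_open r \<eta> = {x \<in> two_pow (Field r). \<eta> \<subseteq>\<^sub>m x}"

definition strong_measure_zero :: "'a rel \<Rightarrow> ('a \<rightharpoonup> bool) set \<Rightarrow> bool" where
  "strong_measure_zero r X \<longleftrightarrow>
    (\<forall>f \<in> Func (Field r) (Field r). \<exists>\<eta> :: 'a \<Rightarrow> ('a \<rightharpoonup> bool).
       (\<forall>i \<in> Field r. \<eta> i \<in> two_pow (underS r (f i))) \<and>
       X \<subseteq> (\<Union>i \<in> Field r. basic_open r (\<eta> i)))"

definition stationary_strong_measure_zero :: "'a rel \<Rightarrow> ('a \<rightharpoonup> bool) set \<Rightarrow> bool" where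
  "stationary_strong_measure_zero r X \<longleftrightarrow>
    (\<forall>f \<in> Func (Field r) (Field r). \<exists>\<eta> :: 'a \<Rightarrow> ('a \<rightharpoonup> bool).
       (\<forall>i \<in> Field r. \<eta> i \<in> two_pow (underS r (f i))) \<and>
       X \<subseteq> (\<Inter>C \<in> {C. club r C}. \<Union>i \<in> C. basic_open r (\<eta> i)))"

end

theory Submission
  imports Defs
begin

text \<open>
  Only the length function \<open>f(i) = i + 1\<close> is needed to refute stationary strong measure zero, and a
  cover \<open>\<eta>\<close> of these lengths matters only through the set \<open>E\<close> of those \<open>i\<close> with \<open>\<eta>\<^sub>i(i) = 1\<close>.

  Given \<open>\<kappa>\<close> many dense open sets and \<open>E \<subseteq> \<kappa>\<close>, build an increasing continuous chain \<open>\<sigma>\<^sub>j\<close> of length \<open>\<kappa>\<close> in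
  \<open>2\<^bsup><\<kappa>\<^esup>\<close>, where \<open>\<sigma>\<^bsub>j+1\<^esub>\<close> first appends to \<open>\<sigma>\<^sub>j\<close> the bit disagreeing with \<open>E\<close> and then moves into the
  \<open>j\<close>-th dense set. The limit \<open>x\<close> lies in all dense sets and disagrees with \<open>E\<close> on the club of the
  lengths of the \<open>\<sigma>\<^sub>j\<close>.

  Since \<open>|2\<^bsup><\<kappa>\<^esup>| = \<kappa>\<close>, half of the indices suffice to give, for each \<open>f\<close>, a dense open set \<open>U\<^sub>f\<close> covered
  with lengths \<open>f(i)\<close>. As \<open>2\<^sup>\<kappa> = \<kappa>\<^sup>+\<close>, enumerate all \<open>f\<close> and all \<open>E\<close> in type \<open>\<kappa>\<^sup>+\<close> and let \<open>x\<^sub>\<alpha>\<close> lie in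
  \<open>U\<^sub>f\<close> for the first \<open>\<alpha> + 1\<close> functions \<open>f\<close> and disagree with \<open>E\<^sub>\<alpha>\<close> on a club. Each \<open>U\<^sub>f\<close> misses at most \<open>\<kappa>\<close>
  many \<open>x\<^sub>\<alpha>\<close>, and the other half of the indices covers these.
\<close>

section \<open>Unions of chains of partial maps\<close>

text \<open>The choice is harmless on chains, whose members agree wherever they overlap.\<close>

definition map_Union :: "('a \<rightharpoonup> 'b) set \<Rightarrow> 'a \<rightharpoonup> 'b" where
  "map_Union M x = (if \<exists>m\<in>M. x \<in> dom m then (SOME m. m \<in> M \<and> x \<in> dom m) x else None)"

lemma dom_map_Union: "dom (map_Union M) = (\<Union>m\<in>M. dom m)"
proof -
  have "x \<in> dom (SOME m. m \<in> M \<and> x \<in> dom m)" if "\<exists>m\<in>M. x \<in> dom m" for x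
    using someI_ex[of "\<lambda>m. m \<in> M \<and> x \<in> dom m"] that by blast
  then show ?thesis
    unfolding map_Union_def by (force simp: dom_def split: if_splits)
qed

lemma map_le_map_Union:
  assumes chain: "\<And>m n. m \<in> M \<Longrightarrow> n \<in> M \<Longrightarrow> m \<subseteq>\<^sub>m n \<or> n \<subseteq>\<^sub>m m" and "m \<in> M"
  shows "m \<subseteq>\<^sub>m map_Union M"
  unfolding map_le_def
proof
  fix x assume x: "x \<in> dom m"
  define n where "n = (SOME m. m \<in> M \<and> x \<in> dom m)"
  have n: "n \<in> M \<and> x \<in> dom n"
    unfolding n_def using x \<open>m \<in> M\<close> by (intro someI_ex[of "\<lambda>m. m \<in> M \<and> x \<in> dom m"]) blast
  then have "m x = n x"
    using chain[of m n] \<open>m \<in> M\<close> x unfolding map_le_def by metis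
  then show "m x = map_Union M x"
    using x \<open>m \<in> M\<close> unfolding map_Union_def n_def by auto
qed

text \<open>Inclusion instead of equality admits an empty \<open>A\<close>, onto which a nonempty
  \<open>B\<close> has no map.\<close>

lemma ordLeq_imp_subset_image:
  assumes "|A| \<le>o |B|"
  shows "\<exists>q. A \<subseteq> q ` B"
  using assms card_of_ordLeq2[of A B] by (cases "A = {}") auto

section \<open>Ordinals below a regular cardinal and the tree of short sequences\<close>

locale regular_cardinal = wo_rel r for r :: "'a rel" +
  assumes card: "Card_order r" and inf: "infinite (Field r)" and reg: "regularCard r"
begin

lemma underS_mono: "(a, b) \<in> r \<Longrightarrow> underS a \<subseteq> underS b"
  using underS_incr[of r] TRANS ANTISYM by blast

lemma in_underS_iff: "a \<in> underS b \<longleftrightarrow> a \<noteq> b \<and> (a, b) \<in> r"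
  by (simp add: underS_def)

lemma le_iff_notin_underS:
  assumes "a \<in> Field r" "b \<in> Field r"
  shows "(a, b) \<in> r \<longleftrightarrow> b \<notin> underS a"
  using assms in_notinI[of b a] ANTISYM REFL unfolding in_underS_iff
  by (metis antisymD refl_onD)

text \<open>An infinite cardinal has no last element, so \<open>under a\<close> is a proper initial
  segment and hence some \<open>underS b\<close>.\<close>

lemma exists_succ:
  assumes "a \<in> Field r"
  shows "\<exists>b\<in>Field r. underS b = insert a (underS a)"
proof -
  obtain c where c: "c \<in> Field r" "a \<noteq> c" "(a, c) \<in> r"
    using infinite_Card_order_limit[OF card inf assms] by blast
  then have "c \<notin> under a"
    using ANTISYM by (auto simp: under_def antisym_def)
  then have "\<exists>b\<in>Field r. under a = underS b"
    using under_ofilter[of a] ofilter_underS_Field[of "under a"] c by auto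
  moreover have "under a = insert a (underS a)"
    using Refl_under_underS[OF REFL assms] by auto
  ultimately show ?thesis by auto
qed

text \<open>\<open>seqs\<close> is the tree \<open>2\<^bsup><\<kappa>\<^esup>\<close>.\<close>

definition seqs :: "('a \<rightharpoonup> bool) set" where
  "seqs = (\<Union>a\<in>Field r. two_pow (underS a))"

text \<open>For a member of \<open>seqs\<close> the domain is an initial segment, so the least
  ordinal outside it is the length.\<close>

definition len :: "('a \<rightharpoonup> bool) \<Rightarrow> 'a" where
  "len \<sigma> = minim (Field r - dom \<sigma>)"

lemma seqs_len:
  assumes "\<sigma> \<in> seqs"
  shows "len \<sigma> \<in> Field r" and "dom \<sigma> = underS (len \<sigma>)"
proof -
  obtain a where a: "a \<in> Field r" "dom \<sigma> = underS a"
    using assms by (auto simp: seqs_def two_pow_def)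
  have "a = len \<sigma>"
    unfolding len_def using a underS_notIn[of a r] le_iff_notin_underS[OF a(1)]
    by (intro equals_minim) auto
  with a show "len \<sigma> \<in> Field r" "dom \<sigma> = underS (len \<sigma>)" by auto
qed

lemma seqsI: "a \<in> Field r \<Longrightarrow> dom \<sigma> = underS a \<Longrightarrow> \<sigma> \<in> seqs"
  by (auto simp: seqs_def two_pow_def)

lemma seqs_ofilterI:
  assumes "ofilter (dom \<sigma>)" "dom \<sigma> \<noteq> Field r"
  shows "\<sigma> \<in> seqs"
  using assms ofilter_underS_Field seqsI by metis

lemma seqs_snoc:
  assumes "\<sigma> \<in> seqs"
  shows "\<sigma>(len \<sigma> \<mapsto> b) \<in> seqs" and "\<sigma> \<subseteq>\<^sub>m \<sigma>(len \<sigma> \<mapsto> b)"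
proof -
  obtain c where "c \<in> Field r" "underS c = insert (len \<sigma>) (underS (len \<sigma>))"
    using exists_succ seqs_len[OF assms] by blast
  then show "\<sigma>(len \<sigma> \<mapsto> b) \<in> seqs"
    using seqs_len[OF assms] by (intro seqsI) auto
  have "len \<sigma> \<notin> dom \<sigma>"
    using seqs_len[OF assms] underS_notIn by metis
  then show "\<sigma> \<subseteq>\<^sub>m \<sigma>(len \<sigma> \<mapsto> b)"
    by (auto simp: map_le_def)
qed

lemma small_bounded:
  assumes "|A| <o r" "A \<subseteq> Field r"
  shows "\<exists>b\<in>Field r. \<forall>a\<in>A. (a, b) \<in> r"
proof -
  have "\<not> cofinal A r"
    using assms reg not_ordLess_ordIso unfolding regularCard_def by blast
  then obtain b where b: "b \<in> Field r" "\<And>a. a \<in> A \<Longrightarrow> b = a \<or> (b, a) \<notin> r"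
    unfolding cofinal_def by blast
  then have "\<forall>a\<in>A. (a, b) \<in> r"
    using assms in_notinI by blast
  with b show ?thesis by blast
qed

text \<open>Membership in \<open>seqs\<close> depends on the domain alone: a union of initial
  segments is one again, and regularity bounds fewer than \<kappa> lengths, which keeps it
  proper.\<close>

lemma map_Union_in_seqs:
  assumes "M \<subseteq> seqs" "|M| <o r"
  shows "map_Union M \<in> seqs"
proof (rule seqs_ofilterI)
  show "ofilter (dom (map_Union M))"
    unfolding dom_map_Union
  proof (rule ofilter_UNION)
    fix m assume "m \<in> M"
    then show "ofilter (dom m)"
      using assms(1) seqs_len(2)[of m] underS_ofilter by auto
  qed
  have "|len ` M| <o r"
    using assms(2) card_of_image ordLeq_ordLess_trans by blast
  moreover have "len ` M \<subseteq> Field r"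
    using assms(1) seqs_len by blast
  ultimately obtain b where b: "b \<in> Field r" "\<forall>a\<in>len ` M. (a, b) \<in> r"
    using small_bounded by blast
  have "b \<notin> dom (map_Union M)"
  proof
    assume "b \<in> dom (map_Union M)"
    then obtain m where m: "m \<in> M" "b \<in> dom m"
      unfolding dom_map_Union by blast
    then have "m \<in> seqs" using assms(1) by blast
    then show False
      using b m seqs_len[of m] le_iff_notin_underS[of "len m" b] by blast
  qed
  then show "dom (map_Union M) \<noteq> Field r" using b by blast
qed

text \<open>Each of the \<kappa> levels has size below \<kappa>, because \<kappa> is a strong
  limit.\<close>

lemma card_seqs:
  assumes "strong_limit r"
  shows "|seqs| \<le>o r"
  unfolding seqs_def
proof (rule card_of_UNION_ordLeq_infinite_Field[OF inf card])
  show "|Field r| \<le>o r"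
    using card card_of_Field_ordIso ordIso_iff_ordLeq by blast
  show "\<forall>a\<in>Field r. |two_pow (underS a)| \<le>o r"
  proof
    fix a assume "a \<in> Field r"
    then have "|underS a| <o r"
      by (rule card_of_underS[OF card])
    then have "ctwo ^c |underS a| <o r"
      using assms card_of_Card_order[of "underS a"] unfolding strong_limit_def by blast
    then have less: "|Func (underS a) (UNIV :: bool set)| <o r"
      by (simp add: cexp_def ctwo_def Field_card_of)
    \<comment> \<open>Partial maps with domain \<open>underS a\<close> are coded as total functions
      that are \<open>undefined\<close> elsewhere, as \<open>Func\<close> demands.\<close>
    have "inj_on (\<lambda>x i. if i \<in> underS a then the (x i) else undefined) (two_pow (underS a))"
    proof (rule inj_onI)
      fix x y :: "'a \<rightharpoonup> bool"
      assume xy: "x \<in> two_pow (underS a)" "y \<in> two_pow (underS a)"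
        and eq: "(\<lambda>i. if i \<in> underS a then the (x i) else undefined) =
          (\<lambda>i. if i \<in> underS a then the (y i) else undefined)"
      show "x = y"
      proof
        fix i
        have "i \<in> underS a \<longleftrightarrow> x i \<noteq> None" "i \<in> underS a \<longleftrightarrow> y i \<noteq> None"
          using xy by (auto simp: two_pow_def)
        then show "x i = y i"
          using fun_cong[OF eq, of i] by (cases "i \<in> underS a") auto
      qed
    qed
    moreover have "(\<lambda>x i. if i \<in> underS a then the (x i) else undefined) ` two_pow (underS a)
        \<subseteq> Func (underS a) (UNIV :: bool set)"
      by (auto simp: Func_def)
    ultimately have "|two_pow (underS a)| \<le>o |Func (underS a) (UNIV :: bool set)|"
      using card_of_ordLeq by blast
    then show "|two_pow (underS a)| \<le>o r"
      using less ordLeq_ordLess_trans ordLess_imp_ordLeq by blast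
  qed
qed

section \<open>Dense open sets and generic sequences\<close>

text \<open>In the topology with basis \<open>basic_open r \<sigma>\<close> for \<sigma> in
  \<open>seqs\<close>, this says that \<open>D\<close> includes a dense open set; \<open>D\<close>
  itself need not be open.\<close>

definition dense_open :: "('a \<rightharpoonup> bool) set \<Rightarrow> bool" where
  "dense_open D \<longleftrightarrow> (\<forall>\<sigma>\<in>seqs. \<exists>\<tau>\<in>seqs. \<sigma> \<subseteq>\<^sub>m \<tau> \<and> basic_open r \<tau> \<subseteq> D)"

lemma dense_openE:
  assumes "dense_open D"
  obtains h where "\<And>\<sigma>. \<sigma> \<in> seqs \<Longrightarrow> h \<sigma> \<in> seqs" "\<And>\<sigma>. \<sigma> \<in> seqs \<Longrightarrow> \<sigma> \<subseteq>\<^sub>m h \<sigma>"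
    "\<And>\<sigma>. \<sigma> \<in> seqs \<Longrightarrow> basic_open r (h \<sigma>) \<subseteq> D"
  using assms unfolding dense_open_def by metis

text \<open>A Baire category construction of length \<kappa>. The club consists of the lengths
  reached on the way; it is closed because unions are taken at limits.\<close>

lemma generic_avoiding:
  assumes dense: "\<And>j. j \<in> Field r \<Longrightarrow> dense_open (D j)"
  obtains x C where "x \<in> two_pow (Field r)" "\<And>j. j \<in> Field r \<Longrightarrow> x \<in> D j"
    "club r C" "\<And>i. i \<in> C \<Longrightarrow> x i = Some (i \<notin> E)"
proof -
  have "\<forall>j\<in>Field r. \<exists>h. \<forall>\<sigma>\<in>seqs. h \<sigma> \<in> seqs \<and> \<sigma> \<subseteq>\<^sub>m h \<sigma> \<and> basic_open r (h \<sigma>) \<subseteq> D j"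
    using dense dense_openE by metis
  then obtain h where h: "\<And>j \<sigma>. j \<in> Field r \<Longrightarrow> \<sigma> \<in> seqs \<Longrightarrow>
      h j \<sigma> \<in> seqs \<and> \<sigma> \<subseteq>\<^sub>m h j \<sigma> \<and> basic_open r (h j \<sigma>) \<subseteq> D j"
    by metis
  \<comment> \<open>The bit is appended before \<open>h j\<close> extends, so that it sits at
    position \<open>len \<sigma>\<close>, the ordinal that enters the club.\<close>
  define step where "step j \<sigma> = h j (\<sigma>(len \<sigma> \<mapsto> len \<sigma> \<notin> E))" for j \<sigma>
  have step: "step j \<sigma> \<in> seqs" "\<sigma> \<subseteq>\<^sub>m step j \<sigma>" "basic_open r (step j \<sigma>) \<subseteq> D j"
      "step j \<sigma> (len \<sigma>) = Some (len \<sigma> \<notin> E)" if "j \<in> Field r" "\<sigma> \<in> seqs" for j \<sigma>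
  proof -
    let ?\<sigma> = "\<sigma>(len \<sigma> \<mapsto> len \<sigma> \<notin> E)"
    note * = h[OF that(1) seqs_snoc(1)[OF that(2)], of "len \<sigma> \<notin> E", folded step_def]
    show "step j \<sigma> \<in> seqs" "\<sigma> \<subseteq>\<^sub>m step j \<sigma>" "basic_open r (step j \<sigma>) \<subseteq> D j"
      using * seqs_snoc(2)[OF that(2), of "len \<sigma> \<notin> E"] map_le_trans by blast+
    have "len \<sigma> \<in> dom ?\<sigma>" by simp
    then have "?\<sigma> (len \<sigma>) = step j \<sigma> (len \<sigma>)"
      using * unfolding map_le_def by blast
    then show "step j \<sigma> (len \<sigma>) = Some (len \<sigma> \<notin> E)" by simp
  qed
  \<comment> \<open>One formula serves every stage: the empty map at zero,
    \<open>step i (s i)\<close> at the successor of \<open>i\<close>, and the union of the earlier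
    stages at a limit.\<close>
  define H where "H s j = map_Union ((\<lambda>i. step i (s i)) ` underS j)" for s j
  define s where "s = worec H"
  have "adm_wo H"
    unfolding adm_wo_def H_def by (auto intro!: arg_cong[of _ _ map_Union] image_cong)
  then have s: "s j = map_Union ((\<lambda>i. step i (s i)) ` underS j)" for j
    using fun_cong[OF worec_fixpoint, of H j] unfolding s_def[symmetric] by (simp only: H_def)
  \<comment> \<open>The two claims need a joint induction: that the steps below \<open>j\<close>
    form a chain uses both of them at smaller indices.\<close>
  have inv: "j \<in> Field r \<longrightarrow> s j \<in> seqs \<and> (\<forall>i\<in>underS j. step i (s i) \<subseteq>\<^sub>m s j)" for j
  proof (induction j rule: well_order_induct)
    case (1 j)
    show ?case
    proof
      assume j: "j \<in> Field r"
      let ?M = "(\<lambda>i. step i (s i)) ` underS j"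
      have F: "i \<in> Field r" if "i \<in> underS j" for i
        using that underS_Field by fast
      have IH: "s i \<in> seqs" "\<And>k. k \<in> underS i \<Longrightarrow> step k (s k) \<subseteq>\<^sub>m s i" if "i \<in> underS j" for i
        using mp[OF mp[OF spec[OF 1]], of i] that F[OF that] by (simp_all add: in_underS_iff)
      have "?M \<subseteq> seqs"
        using step(1) IH(1) F by blast
      moreover have "|?M| <o r"
        using card_of_image card_of_underS[OF card j] ordLeq_ordLess_trans by blast
      ultimately have "s j \<in> seqs"
        unfolding s[of j] by (rule map_Union_in_seqs)
      have le: "step k (s k) \<subseteq>\<^sub>m step i (s i)" if "k \<in> underS i" "i \<in> underS j" for i k
        using that IH[OF that(2)] step(2)[OF F[OF that(2)]] map_le_trans by blast
      have "m \<subseteq>\<^sub>m n \<or> n \<subseteq>\<^sub>m m" if mn: "m \<in> ?M" "n \<in> ?M" for m n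
      proof -
        obtain i k where ik: "i \<in> underS j" "k \<in> underS j" "m = step i (s i)" "n = step k (s k)"
          using mn by blast
        then have "i = k \<or> i \<in> underS k \<or> k \<in> underS i"
          using F TOTALS in_underS_iff by metis
        then show ?thesis
          using ik le by auto
      qed
      then have "\<forall>m\<in>?M. m \<subseteq>\<^sub>m s j"
        unfolding s[of j] by (intro ballI map_le_map_Union)
      with \<open>s j \<in> seqs\<close> show "s j \<in> seqs \<and> (\<forall>i\<in>underS j. step i (s i) \<subseteq>\<^sub>m s j)" by blast
    qed
  qed
  have s_seqs: "s j \<in> seqs" if "j \<in> Field r" for j
    using inv that by blast
  note len_s = seqs_len[OF s_seqs]
  have s_step: "step i (s i) \<subseteq>\<^sub>m s j" if "i \<in> underS j" "j \<in> Field r" for i j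
    using inv that by blast
  have len_in: "len (s i) \<in> dom (step i (s i))" if "i \<in> Field r" for i
    using step(4)[OF that s_seqs[OF that]] by auto
  have len_less: "len (s i) \<in> underS (len (s j))" if "i \<in> underS j" "j \<in> Field r" for i j
  proof -
    have "i \<in> Field r" using that underS_Field by fast
    then show ?thesis
      using len_in s_step[OF that] len_s[OF that(2)] map_le_implies_dom_le by blast
  qed
  have mono: "i \<in> underS j" if "len (s i) \<in> underS (len (s j))" "i \<in> Field r" "j \<in> Field r" for i j
  proof (rule ccontr)
    assume "i \<notin> underS j"
    then have "j = i \<or> j \<in> underS i"
      using that TOTALS in_underS_iff by metis
    then have "(len (s j), len (s i)) \<in> r"
      using len_less[of j i] that REFL len_s(1) in_underS_iff by (metis refl_onD)
    then show False
      using that le_iff_notin_underS[of "len (s j)" "len (s i)"] len_s(1) by blast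
  qed
  define C where "C = (\<lambda>j. len (s j)) ` Field r"
  have C_sub: "C \<subseteq> Field r"
    using len_s(1) by (auto simp: C_def)
  \<comment> \<open>Strictly increasing lengths give \<open>C\<close> full size \<kappa>, so no
    \<open>underS b\<close> includes it; cofinality follows from this.\<close>
  have "inj_on (\<lambda>j. len (s j)) (Field r)"
  proof (rule inj_onI, rule ccontr)
    fix i j assume "i \<in> Field r" "j \<in> Field r" "len (s i) = len (s j)" "i \<noteq> j"
    then show False
      using len_less[of i j] len_less[of j i] TOTALS in_underS_iff by metis
  qed
  then have "|Field r| \<le>o |C|"
    unfolding C_def by (intro card_of_ordLeqI) auto
  then have rC: "r \<le>o |C|"
    using card card_of_Field_ordIso ordIso_symmetric ordIso_ordLeq_trans by blast
  have cof: "cofinal C r"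
    unfolding cofinal_def
  proof (rule ballI, rule ccontr)
    fix a assume a: "a \<in> Field r" and "\<not> (\<exists>b\<in>C. a \<noteq> b \<and> (a, b) \<in> r)"
    then have "\<forall>c\<in>C. (c, a) \<in> r"
      using C_sub in_notinI by blast
    moreover obtain b where b: "b \<in> Field r" "underS b = insert a (underS a)"
      using exists_succ[OF a] by blast
    ultimately have "C \<subseteq> underS b"
      by (auto simp: in_underS_iff)
    then have "|C| <o r"
      using card_of_underS[OF card b(1)] card_of_mono1 ordLeq_ordLess_trans by blast
    with rC show False
      using not_ordLess_ordLeq by blast
  qed
  have "club r C"
    unfolding club_def
  proof (intro conjI ballI impI C_sub cof)
    fix d assume d: "d \<in> Field r"
      and lim: "underS d \<noteq> {} \<and> (\<forall>b\<in>underS d. \<exists>c\<in>C \<inter> underS d. b \<noteq> c \<and> (b, c) \<in> r)"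
    \<comment> \<open>The index for \<open>d\<close> is the first stage of length at least
      \<open>d\<close>; it remains to bound that length by \<open>d\<close>.\<close>
    let ?J = "{j \<in> Field r. (d, len (s j)) \<in> r}"
    define j where "j = minim ?J"
    have "?J \<noteq> {}"
      using cof d unfolding cofinal_def C_def by blast
    then have j: "j \<in> Field r" "(d, len (s j)) \<in> r"
      using minim_in[of ?J] unfolding j_def by auto
    have below: "len (s i) \<in> underS d" if "i \<in> underS j" for i
    proof (rule ccontr)
      assume "len (s i) \<notin> underS d"
      have i: "i \<in> Field r" using that underS_Field by fast
      then have "i \<in> ?J"
        using \<open>len (s i) \<notin> underS d\<close> le_iff_notin_underS d len_s(1) by blast
      then have "(j, i) \<in> r"
        unfolding j_def by (intro minim_least) auto
      then show False
        using that le_iff_notin_underS j(1) i by blast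
    qed
    \<comment> \<open>The limit hypothesis on \<open>d\<close> enters here: between
      \<open>len (s i)\<close> and \<open>d\<close> lies some \<open>len (s k)\<close>, and
      \<open>s k\<close> already extends \<open>step i (s i)\<close>.\<close>
    have "dom (s j) \<subseteq> underS d"
    proof
      fix y assume "y \<in> dom (s j)"
      then obtain i where i: "i \<in> underS j" "y \<in> dom (step i (s i))"
        unfolding s[of j] dom_map_Union by blast
      have iF: "i \<in> Field r" using i underS_Field by fast
      obtain c where c: "c \<in> C" "c \<in> underS d" "len (s i) \<in> underS c"
        using bspec[OF conjunct2[OF lim] below[OF i(1)]] by (auto simp: in_underS_iff)
      then obtain k where k: "k \<in> Field r" "len (s k) \<in> underS d" "len (s i) \<in> underS (len (s k))"
        unfolding C_def by blast
      then have "step i (s i) \<subseteq>\<^sub>m s k"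
        using mono[OF _ iF] s_step by blast
      then have "y \<in> underS (len (s k))"
        using i len_s(2)[OF k(1)] map_le_implies_dom_le by blast
      then show "y \<in> underS d"
        using underS_mono[of "len (s k)" d] k(2)[unfolded in_underS_iff] by blast
    qed
    then have "(len (s j), d) \<in> r"
      using len_s[OF j(1)] le_iff_notin_underS[of "len (s j)" d] d underS_notIn by fast
    then have "d = len (s j)"
      using j ANTISYM by (auto simp: antisym_def)
    then show "d \<in> C"
      using j by (auto simp: C_def)
  qed
  define x where "x = map_Union (s ` Field r)"
  have s_mono: "s i \<subseteq>\<^sub>m s j" if "i \<in> underS j" "j \<in> Field r" for i j
  proof -
    have "i \<in> Field r" using that underS_Field by fast
    then show ?thesis
      using step(2) s_seqs s_step[OF that] map_le_trans by blast
  qed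
  have "m \<subseteq>\<^sub>m n \<or> n \<subseteq>\<^sub>m m" if mn: "m \<in> s ` Field r" "n \<in> s ` Field r" for m n
  proof -
    obtain i k where ik: "i \<in> Field r" "k \<in> Field r" "m = s i" "n = s k"
      using mn by blast
    then have "i = k \<or> i \<in> underS k \<or> k \<in> underS i"
      using TOTALS in_underS_iff by metis
    then show ?thesis
      using ik s_mono by auto
  qed
  then have s_le: "s j \<subseteq>\<^sub>m x" if "j \<in> Field r" for j
    using map_le_map_Union that unfolding x_def by blast
  have step_le: "step j (s j) \<subseteq>\<^sub>m x" if j: "j \<in> Field r" for j
  proof -
    obtain k where "k \<in> Field r" "j \<in> underS k"
      using exists_succ[OF j] by blast
    then show ?thesis
      using s_step s_le map_le_trans by blast
  qed
  have "Field r \<subseteq> dom x"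
  proof
    fix a assume "a \<in> Field r"
    then obtain j where "j \<in> Field r" "a \<in> underS (len (s j))"
      using cof unfolding cofinal_def C_def in_underS_iff by blast
    then show "a \<in> dom x"
      using len_s(2) s_le map_le_implies_dom_le by blast
  qed
  moreover have "dom x \<subseteq> Field r"
    unfolding x_def dom_map_Union using len_s(2) underS_Field by fast
  ultimately have x: "x \<in> two_pow (Field r)"
    by (auto simp: two_pow_def)
  show thesis
  proof (rule that[OF x _ \<open>club r C\<close>])
    show "x \<in> D j" if "j \<in> Field r" for j
      using step(3)[OF that s_seqs[OF that]] step_le[OF that] x unfolding basic_open_def by blast
    show "x i = Some (i \<notin> E)" if "i \<in> C" for i
    proof -
      obtain j where j: "j \<in> Field r" "i = len (s j)"
        using \<open>i \<in> C\<close> unfolding C_def by blast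
      then show ?thesis
        using step(4)[OF _ s_seqs] step_le[OF j(1)] len_in[OF j(1)] unfolding map_le_def by metis
    qed
  qed
qed

section \<open>Covers with prescribed lengths\<close>

text \<open>The sequence \<open>\<sigma>\<close> padded with zeros or truncated to length \<open>a\<close>.\<close>

definition fit :: "'a \<Rightarrow> ('a \<rightharpoonup> bool) \<Rightarrow> 'a \<rightharpoonup> bool" where
  "fit a \<sigma> i = (if i \<in> underS a then if i \<in> dom \<sigma> then \<sigma> i else Some False else None)"

lemma fit_two_pow: "fit a \<sigma> \<in> two_pow (underS a)"
  by (auto simp: fit_def two_pow_def dom_def)

lemma fit_map_le:
  assumes "x \<in> two_pow (Field r)"
  shows "fit a x \<subseteq>\<^sub>m x"
  using assms by (auto simp: fit_def two_pow_def map_le_def dest: underS_Field split: if_splits)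

text \<open>Each \<sigma> is itself listed at some index \<open>i\<close>, and its fitted version is
  compatible with it whatever length \<open>f i\<close> prescribes.\<close>

lemma dense_open_fit:
  assumes f: "\<And>i. i \<in> Field r \<Longrightarrow> f i \<in> Field r"
    and t: "\<And>\<sigma>. \<sigma> \<in> seqs \<Longrightarrow> \<exists>i\<in>I. t i = \<sigma>" and I: "I \<subseteq> Field r"
  shows "dense_open (\<Union>i\<in>I. basic_open r (fit (f i) (t i)))"
  unfolding dense_open_def
proof
  fix \<sigma> assume \<sigma>: "\<sigma> \<in> seqs"
  then obtain i where i: "i \<in> I" "t i = \<sigma>" using t by blast
  then have fi: "f i \<in> Field r" using I f by blast
  \<comment> \<open>This is \<sigma> itself if \<open>f i\<close> is at most
    \<open>len \<sigma>\<close>, and otherwise \<sigma> padded with zeros to length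
    \<open>f i\<close>.\<close>
  let ?\<tau> = "fit (f i) \<sigma> ++ \<sigma>"
  have "dom ?\<tau> = underS (len \<sigma>) \<union> underS (f i)"
    using seqs_len(2)[OF \<sigma>] fit_two_pow[of "f i" \<sigma>] by (simp add: two_pow_def)
  moreover have "underS (len \<sigma>) \<subseteq> underS (f i) \<or> underS (f i) \<subseteq> underS (len \<sigma>)"
    using underS_ofilter ofilter_linord by blast
  ultimately have "dom ?\<tau> = underS (len \<sigma>) \<or> dom ?\<tau> = underS (f i)"
    by auto
  then have "?\<tau> \<in> seqs"
    using seqsI fi seqs_len(1)[OF \<sigma>] by blast
  moreover have "fit (f i) \<sigma> \<subseteq>\<^sub>m ?\<tau>"
    by (auto simp: map_le_def fit_def map_add_def split: option.splits if_splits)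
  then have "basic_open r ?\<tau> \<subseteq> basic_open r (fit (f i) (t i))"
    using i map_le_trans unfolding basic_open_def by blast
  ultimately show "\<exists>\<tau>\<in>seqs. \<sigma> \<subseteq>\<^sub>m \<tau> \<and> basic_open r \<tau> \<subseteq> (\<Union>i\<in>I. basic_open r (fit (f i) (t i)))"
    using i by (intro bexI[of _ ?\<tau>]) auto
qed

text \<open>\<open>t\<close> splits the indices in two: those sent to \<open>Inl\<close> list the
  tree and yield the dense open set, those sent to \<open>Inr\<close> cover the at most \<kappa>
  remaining points one by one.\<close>

lemma strong_measure_zeroI:
  assumes t: "t ` Field r = seqs <+> Field r"
    and X: "X \<subseteq> two_pow (Field r)"
    and small: "\<And>f. f \<in> Func (Field r) (Field r) \<Longrightarrow>
      |X - (\<Union>i\<in>{i \<in> Field r. isl (t i)}. basic_open r (fit (f i) (projl (t i))))| \<le>o r"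
  shows "strong_measure_zero r X"
  unfolding strong_measure_zero_def
proof
  fix f assume f: "f \<in> Func (Field r) (Field r)"
  let ?U = "\<Union>i\<in>{i \<in> Field r. isl (t i)}. basic_open r (fit (f i) (projl (t i)))"
  have "|X - ?U| \<le>o |Field r|"
    using small[OF f] card_of_Field_ordIso[OF card] ordIso_symmetric ordLeq_ordIso_trans by blast
  then obtain q where q: "X - ?U \<subseteq> q ` Field r"
    using ordLeq_imp_subset_image by blast
  \<comment> \<open>On the second kind of index, a remaining point \<open>q k\<close> is truncated
    to length \<open>f i\<close>, so its basic set contains it.\<close>
  define \<eta> where "\<eta> i = fit (f i) (case t i of Inl \<sigma> \<Rightarrow> \<sigma> | Inr k \<Rightarrow> q k)" for i
  have "x \<in> (\<Union>i\<in>Field r. basic_open r (\<eta> i))" if x: "x \<in> X" for x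
  proof (cases "x \<in> ?U")
    case True
    then obtain i where "i \<in> Field r" "isl (t i)" "x \<in> basic_open r (fit (f i) (projl (t i)))"
      by blast
    then show ?thesis
      by (intro UN_I[of i]) (auto simp: \<eta>_def split: sum.splits)
  next
    case False
    then obtain k where k: "k \<in> Field r" "x = q k"
      using q x by blast
    then have "Inr k \<in> t ` Field r" using t by auto
    then obtain i where i: "i \<in> Field r" "t i = Inr k" by (metis imageE)
    then have "\<eta> i \<subseteq>\<^sub>m x"
      using fit_map_le X x k by (auto simp: \<eta>_def)
    then show ?thesis
      using i X x by (auto simp: basic_open_def)
  qed
  then show "\<exists>\<eta>. (\<forall>i\<in>Field r. \<eta> i \<in> two_pow (underS (f i))) \<and> X \<subseteq> (\<Union>i\<in>Field r. basic_open r (\<eta> i))"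
    using fit_two_pow unfolding \<eta>_def by (intro exI[of _ \<eta>]) (auto simp: \<eta>_def)
qed

text \<open>With lengths \<open>i + 1\<close> the bit of \<open>\<eta> i\<close> at \<open>i\<close>
  is defined. If \<open>E\<close> collects the indices where it is one, a point disagreeing with
  \<open>E\<close> on \<open>C\<close> extends no \<open>\<eta> i\<close> with \<open>i\<close> in
  \<open>C\<close>.\<close>

lemma not_stationary_strong_measure_zeroI:
  assumes "\<And>E. E \<subseteq> Field r \<Longrightarrow> \<exists>x\<in>X. \<exists>C. club r C \<and> (\<forall>i\<in>C. x i = Some (i \<notin> E))"
  shows "\<not> stationary_strong_measure_zero r X"
proof
  assume stat: "stationary_strong_measure_zero r X"
  obtain g where g: "\<And>a. a \<in> Field r \<Longrightarrow> g a \<in> Field r \<and> underS (g a) = insert a (underS a)"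
    using exists_succ by metis
  define f where "f a = (if a \<in> Field r then g a else undefined)" for a
  have "f \<in> Func (Field r) (Field r)"
    using g by (auto simp: Func_def f_def)
  from bspec[OF stat[unfolded stationary_strong_measure_zero_def] this]
  obtain \<eta> where \<eta>: "\<forall>i\<in>Field r. \<eta> i \<in> two_pow (underS (f i))"
    and cover: "X \<subseteq> (\<Inter>C\<in>{C. club r C}. \<Union>i\<in>C. basic_open r (\<eta> i))"
    by (elim exE conjE)
  define E where "E = {i \<in> Field r. \<eta> i i = Some True}"
  then have "E \<subseteq> Field r" by blast
  obtain x C where x: "x \<in> X" "club r C" "\<And>i. i \<in> C \<Longrightarrow> x i = Some (i \<notin> E)"
    using assms[OF \<open>E \<subseteq> Field r\<close>] by blast
  then obtain i where i: "i \<in> C" "\<eta> i \<subseteq>\<^sub>m x"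
    using subsetD[OF cover x(1)] unfolding basic_open_def by blast
  have iF: "i \<in> Field r" using i x(2) by (auto simp: club_def)
  then have "i \<in> dom (\<eta> i)"
    using bspec[OF \<eta> iF] g[OF iF] by (simp add: two_pow_def f_def)
  then have "\<eta> i i = Some (i \<notin> E)"
    using i x(3) unfolding map_le_def by metis
  then show False
    using iF by (cases "i \<in> E") (simp_all add: E_def)
qed

end

section \<open>Enumerations in type \<open>\<kappa>\<^sup>+\<close> and the final set\<close>

text \<open>\<kappa>^\<kappa> is at most (2^\<kappa>)^\<kappa> = 2^\<kappa>.\<close>

lemma card_Func_self_le_ctwo_cexp:
  assumes "Cinfinite r"
  shows "|Func (Field r) (Field r)| \<le>o ctwo ^c r"
proof -
  have "r ^c r \<le>o (ctwo ^c r) ^c r"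
    using assms ordLess_ctwo_cexp ordLess_imp_ordLeq by (blast intro: cexp_mono1)
  also have "(ctwo ^c r) ^c r =o ctwo ^c r"
    using assms Cinfinite_Cnotzero ordLeq_refl
    by (blast intro: cexp_cprod_ordLeq[OF Card_order_ctwo])
  finally show ?thesis
    by (simp add: cexp_def)
qed

theorem theorem47:
  fixes r :: "'a rel"
  assumes "inaccessible r"
    and "ctwo ^c r =o cardSuc r"
  shows "\<exists>X \<subseteq> two_pow (Field r).
    strong_measure_zero r X \<and> \<not> stationary_strong_measure_zero r X"
proof -
  have card: "Card_order r" and "natLeq <o r" and reg: "regularCard r" and sl: "strong_limit r"
    using assms(1) by (auto simp: inaccessible_def)
  have FrR: "|Field r| =o r"
    by (rule card_of_Field_ordIso[OF card])
  have "natLeq \<le>o |Field r|"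
    using \<open>natLeq <o r\<close> FrR ordIso_symmetric ordLess_ordIso_trans ordLess_imp_ordLeq by blast
  then have inf: "infinite (Field r)"
    using infinite_iff_natLeq_ordLeq by blast
  interpret regular_cardinal r
    using card inf reg by unfold_locales (auto simp: card_order_on_def)
  let ?p = "cardSuc r"
  let ?F = "Func (Field r) (Field r)"
  have cardp: "Card_order ?p"
    by (rule cardSuc_Card_order[OF card])
  have "ctwo ^c r =o |Field ?p|"
    by (rule ordIso_transitive[OF assms(2) ordIso_symmetric[OF card_of_Field_ordIso[OF cardp]]])
  note le_p = ordLeq_ordIso_trans[OF _ this]
  have Fne: "?F \<noteq> {}"
    using inf by (auto simp: Func_is_emp)
  have "|?F| \<le>o |Field ?p|"
    using card inf by (intro le_p card_Func_self_le_ctwo_cexp) (simp add: cinfinite_def)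
  then obtain g where g: "g ` Field ?p = ?F"
    unfolding card_of_ordLeq2[OF Fne, symmetric] ..
  have "|Pow (Field r)| =o ctwo ^c r"
    unfolding ctwo_def cexp_def Field_card_of by (rule card_of_Pow_Func)
  then have "|Pow (Field r)| \<le>o |Field ?p|"
    unfolding ordIso_iff_ordLeq by (intro le_p) (rule conjunct1)
  then obtain e where e: "e ` Field ?p = Pow (Field r)"
    unfolding card_of_ordLeq2[OF Pow_not_empty, symmetric] ..
  \<comment> \<open>The tree has size at most \<kappa>, so \<kappa> indices have room for it and a
    further copy of \<kappa>.\<close>
  have "|seqs <+> Field r| \<le>o r"
    using inf card card_seqs[OF sl] FrR ordIso_iff_ordLeq
    by (blast intro: card_of_Plus_ordLeq_infinite_Field)
  then have "|seqs <+> Field r| \<le>o |Field r|"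
    using FrR ordIso_symmetric ordLeq_ordIso_trans by blast
  moreover have "seqs <+> Field r \<noteq> {}"
    using inf by auto
  ultimately obtain t where t: "t ` Field r = seqs <+> Field r"
    using card_of_ordLeq2[of "seqs <+> Field r" "Field r"] by blast
  define U where "U f = (\<Union>i\<in>{i \<in> Field r. isl (t i)}. basic_open r (fit (f i) (projl (t i))))" for f
  have U: "dense_open (U f)" if f: "f \<in> ?F" for f
    unfolding U_def
  proof (rule dense_open_fit)
    show "f i \<in> Field r" if "i \<in> Field r" for i
      using f that by (auto simp: Func_def)
    show "\<exists>i\<in>{i \<in> Field r. isl (t i)}. projl (t i) = \<sigma>" if "\<sigma> \<in> seqs" for \<sigma>
    proof -
      have "Inl \<sigma> \<in> t ` Field r" using t that by auto
      then obtain i where "i \<in> Field r" "t i = Inl \<sigma>" by (metis imageE)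
      then show ?thesis by (intro bexI[of _ i]) auto
    qed
  qed auto
  \<comment> \<open>This serves twice: it limits the dense sets to be met by one point, and later
    the points missed by one \<open>U f\<close>.\<close>
  have small: "|Order_Relation.underS ?p \<alpha>| \<le>o r" if "\<alpha> \<in> Field ?p" for \<alpha>
    using card_of_underS[OF cardp that] cardSuc_ordLeq_ordLess[OF card card_of_Card_order] by blast
  have "\<exists>x\<in>two_pow (Field r). (\<forall>\<beta>\<in>insert \<alpha> (Order_Relation.underS ?p \<alpha>). x \<in> U (g \<beta>)) \<and>
      (\<exists>C. club r C \<and> (\<forall>i\<in>C. x i = Some (i \<notin> e \<alpha>)))" if \<alpha>: "\<alpha> \<in> Field ?p" for \<alpha>
  proof -
    let ?A = "insert \<alpha> (Order_Relation.underS ?p \<alpha>)"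
    have "|{\<alpha>} \<union> Order_Relation.underS ?p \<alpha>| \<le>o r"
    proof (rule card_of_Un_ordLeq_infinite_Field[OF inf _ small[OF \<alpha>] card])
      show "|{\<alpha>}| \<le>o r"
        using card inf by (intro Card_order_singl_ordLeq) auto
    qed
    then have "|?A| \<le>o r" by simp
    then have "|?A| \<le>o |Field r|"
      by (rule ordLeq_ordIso_trans[OF _ ordIso_symmetric[OF FrR]])
    \<comment> \<open>Listing the indices up to \<alpha> in type \<kappa>, with repetitions allowed,
      makes the dense sets a \<kappa>-sequence.\<close>
    then obtain q where q: "q ` Field r = ?A"
      using card_of_ordLeq2[of ?A "Field r"] by blast
    have "dense_open (U (g (q j)))" if "j \<in> Field r" for j
    proof -
      have "q j \<in> ?A" using q that by blast
      then have "q j \<in> Field ?p" using \<alpha> underS_Field by fast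
      then show ?thesis using g by (intro U) blast
    qed
    then obtain x C where x: "x \<in> two_pow (Field r)" "\<And>j. j \<in> Field r \<Longrightarrow> x \<in> U (g (q j))"
      "club r C" "\<And>i. i \<in> C \<Longrightarrow> x i = Some (i \<notin> e \<alpha>)"
      using generic_avoiding[of "\<lambda>j. U (g (q j))" "e \<alpha>"] by blast
    have "\<forall>\<beta>\<in>q ` Field r. x \<in> U (g \<beta>)" using x(2) by blast
    then show ?thesis
      using x(1,3,4) unfolding q by blast
  qed
  then obtain x where x: "\<And>\<alpha>. \<alpha> \<in> Field ?p \<Longrightarrow> x \<alpha> \<in> two_pow (Field r) \<and>
      (\<forall>\<beta>\<in>insert \<alpha> (Order_Relation.underS ?p \<alpha>). x \<alpha> \<in> U (g \<beta>)) \<and>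
      (\<exists>C. club r C \<and> (\<forall>i\<in>C. x \<alpha> i = Some (i \<notin> e \<alpha>)))"
    by metis
  let ?X = "x ` Field ?p"
  have X: "?X \<subseteq> two_pow (Field r)" using x by blast
  moreover have "strong_measure_zero r ?X"
  proof (rule strong_measure_zeroI[OF t X])
    fix f assume "f \<in> ?F"
    then obtain \<beta> where \<beta>: "\<beta> \<in> Field ?p" "f = g \<beta>" using g by blast
    interpret p: wo_rel ?p
      using cardSuc_Well_order[OF card] by unfold_locales
    \<comment> \<open>For \<open>f = g \<beta>\<close>, every \<open>x \<alpha>\<close> with
      \<alpha> at or above \<beta> was built inside \<open>U f\<close>, so only smaller indices can
      fail.\<close>
    have "?X - U f \<subseteq> x ` Order_Relation.underS ?p \<beta>"
    proof
      fix y assume "y \<in> ?X - U f"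
      then obtain \<alpha> where \<alpha>: "\<alpha> \<in> Field ?p" "y = x \<alpha>" "x \<alpha> \<notin> U f" by blast
      then have "\<beta> \<noteq> \<alpha>" "\<beta> \<notin> Order_Relation.underS ?p \<alpha>" using x[OF \<alpha>(1)] \<beta>(2) by blast+
      then have "\<alpha> \<in> Order_Relation.underS ?p \<beta>"
        using p.TOTALS \<alpha>(1) \<beta>(1) by (auto simp: underS_def)
      then show "y \<in> x ` Order_Relation.underS ?p \<beta>" using \<alpha> by blast
    qed
    then have "|?X - U f| \<le>o |Order_Relation.underS ?p \<beta>|"
      by (rule ordLeq_transitive[OF card_of_mono1 card_of_image])
    then show "|?X - (\<Union>i\<in>{i \<in> Field r. isl (t i)}. basic_open r (fit (f i) (projl (t i))))| \<le>o r"
      unfolding U_def by (rule ordLeq_transitive[OF _ small[OF \<beta>(1)]])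
  qed
  moreover have "\<not> stationary_strong_measure_zero r ?X"
  proof (rule not_stationary_strong_measure_zeroI)
    fix E assume "E \<subseteq> Field r"
    then have "E \<in> e ` Field ?p" unfolding e by simp
    then obtain \<alpha> where \<alpha>: "\<alpha> \<in> Field ?p" "E = e \<alpha>" by (rule imageE)
    show "\<exists>x\<in>?X. \<exists>C. club r C \<and> (\<forall>i\<in>C. x i = Some (i \<notin> E))"
      using x[OF \<alpha>(1)] \<alpha> by (intro bexI[of _ "x \<alpha>"]) auto
  qed
  ultimately show ?thesis by blast
qed

end
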